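(* Let $p\ge 2$, $r=p-1$, $c\ge 1$ be integers, let $\{I^1,\ldots,I^c\}$ be a partition of $\mathbb{R}$ into connected intervals (left-closed and right-open by convention, endpoints possibly infinite), let $\beta_0^j\in\mathbb{R}$ and $\beta^j\in\mathbb{R}^r$ for $j=1,\ldots,c$, and let $f:\mathbb{R}^r\times\mathbb{R}\to\mathbb{R}$ be the associated simple contextual linear regression function, i.e. for $x=(\hat{x},x_p)\in\mathbb{R}^r\times\mathbb{R}$, $f(x)=\beta_0^j+\beta^j\cdot\hat{x}$ if $x_p\in I^j$. Let $S\subset\mathbb{R}^r$ be compact and let $T\subset\mathbb{R}$ be a bounded interval such that $T\cap I^j\neq\emptyset$ for every $j=1,\ldots,c$. Then there exists a simple contextual neural network (SCtxtNN) for $c$ contexts and $p$ input features, i.e. a choice of real values for all of its weights and biases, whose output function $y:\mathbb{R}^r\times\mathbb{R}\to\mathbb{R}$ satisfies $$y(x)=f(x)\quad\text{for all } x\in S\times T.$$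
   Context: Feature vectors are $x=(x_1,\ldots,x_p)\in\mathbb{R}^p=\mathbb{R}^r\times\mathbb{R}$ with $r=p-1$; write $x=(\hat{x},x_p)$ where $\hat{x}=(x_1,\ldots,x_r)$ is the regressor feature vector and $x_p$ is the single contextual feature. Here $\beta^j\cdot\hat{x}$ is the Euclidean dot product. Left-closed right-open convention: the intervals $I^1,\ldots,I^c$ partition $\mathbb{R}$, and every finite left endpoint belongs to its interval while no finite right endpoint does (so an interval has one of the forms $[s,t)$, $(-\infty,t)$, $[s,\infty)$, $\mathbb{R}$). A simple contextual neural network (SCtxtNN) for $c$ contexts and $p$ features is a function $y:\mathbb{R}^p\to\mathbb{R}$ determined by real parameters $w^{\mathrm{I}}_{1,j}$, $b^{\mathrm{I}}_j$, $w^{\mathrm{X}}_{j,j}$, $b^1_j$, $w^1_{k,j}$, $w^2_{j,1}$ ($j=1,\ldots,2c$, $k=1,\ldots,r$) and $b^2_1$, through the following formulas. (1) Contextual sub-network ($2c$ perceptron units): $a^{\mathrm{I}}_j=\tilde{a}\left(w^{\mathrm{I}}_{1,j}x_p+b^{\mathrm{I}}_j\right)$ for $j=1,\ldots,2c$, where $\tilde{a}(z)=1$ if $z>0$ and $\tilde{a}(z)=0$ otherwise. (2) Hidden layer of the regression sub-network ($2c$ ReLU units): $a^1_j=a\left(\sum_{k=1}^{r}w^1_{k,j}x_k+b^1_j+w^{\mathrm{X}}_{j,j}a^{\mathrm{I}}_j\right)$ for $j=1,\ldots,2c$, where $a(z)=\max(0,z)$. (3) Output: $y(x)=\sum_{k=1}^{2c}w^2_{k,1}a^1_k+b^2_1$.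 *)

theory Defs
  imports "HOL-Analysis.Analysis"
begin

(* The p = CARD('r) + 1 features are split as (real ^ 'r) \<times> real: the regressor
   features and the single contextual feature.  As finite types are nonempty, p >= 2.
   Contexts are indexed by {1..c} and network units by {1..2 * c}. *)

definition lcro_interval :: "real set \<Rightarrow> bool" where
  "lcro_interval J \<longleftrightarrow>
     (\<exists>s t. s < t \<and> J = {s..<t}) \<or> (\<exists>t. J = {..<t}) \<or> (\<exists>s. J = {s..}) \<or> J = UNIV"

(* Injectivity makes the c listed intervals distinct, so that they are c disjoint contexts. *)
definition context_partition :: "nat \<Rightarrow> (nat \<Rightarrow> real set) \<Rightarrow> bool" where
  "context_partition c I \<longleftrightarrow>
     inj_on I {1..c} \<and> partition_on UNIV (I ` {1..c}) \<and> (\<forall>j\<in>{1..c}. lcro_interval (I j))"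

(* When context_partition c I holds, exactly one f satisfies this. *)
definition ctxt_linear_regression ::
  "nat \<Rightarrow> (nat \<Rightarrow> real set) \<Rightarrow> (nat \<Rightarrow> real) \<Rightarrow> (nat \<Rightarrow> real ^ 'r) \<Rightarrow> ((real ^ 'r) \<times> real \<Rightarrow> real) \<Rightarrow> bool"
  where
  "ctxt_linear_regression c I \<beta>0 \<beta> f \<longleftrightarrow>
     (\<forall>j\<in>{1..c}. \<forall>xh xp. xp \<in> I j \<longrightarrow> f (xh, xp) = \<beta>0 j + \<beta> j \<bullet> xh)"

definition heaviside :: "real \<Rightarrow> real" where
  "heaviside z = (if z > 0 then 1 else 0)"

definition relu :: "real \<Rightarrow> real" where
  "relu z = max 0 z"

(* The matrix w_X is diagonal, hence a single index.  Only the entries of the weight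
   functions with unit index in {1..2 * c} are used. *)
record 'r sctxtnn =
  w_I :: "nat \<Rightarrow> real"
  b_I :: "nat \<Rightarrow> real"
  w_X :: "nat \<Rightarrow> real"
  b_1 :: "nat \<Rightarrow> real"
  w_1 :: "'r \<Rightarrow> nat \<Rightarrow> real"
  w_2 :: "nat \<Rightarrow> real"
  b_2 :: real

definition ctxt_unit :: "'r sctxtnn \<Rightarrow> real \<Rightarrow> nat \<Rightarrow> real" where
  "ctxt_unit N xp j = heaviside (w_I N j * xp + b_I N j)"

definition hidden_unit :: "('r::finite) sctxtnn \<Rightarrow> (real ^ 'r) \<times> real \<Rightarrow> nat \<Rightarrow> real" where
  "hidden_unit N x j =
     relu ((\<Sum>k\<in>UNIV. w_1 N k j * fst x $ k) + b_1 N j + w_X N j * ctxt_unit N (snd x) j)"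

definition sctxtnn_output :: "nat \<Rightarrow> ('r::finite) sctxtnn \<Rightarrow> (real ^ 'r) \<times> real \<Rightarrow> real" where
  "sctxtnn_output c N x = (\<Sum>k = 1..2 * c. w_2 N k * hidden_unit N x k) + b_2 N"

end

theory Submission
  imports Defs
begin

(* Let U j be the up-closure of I j, i.e. the half-line starting at the left endpoint of I j
   (or the whole line).  A function that is constant on each I j is a combination of the indicators
   of the U j; applied to the coefficient vectors this writes f as the sum over j of affine maps g j
   gated by x_p in U j.  Each gated map costs two hidden units.  If |g| <= M on S and h is the value
   (0 on U j, 1 off it) of a perceptron, then relu (g + M - 2 M h) - relu (M - M h) equals g
   on U j and 0 off it. *)

text \<open>A new maximum \<open>m\<close> enters only the prefix sum at \<open>m\<close> itself, so
  adding elements in increasing order leaves the earlier equations intact and the last one can be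
  solved for \<open>d m\<close> by subtraction.\<close>

lemma exists_prefix_sum_inverse:
  fixes v :: "'a :: linorder \<Rightarrow> 'b :: ab_group_add"
  assumes "finite A"
  shows "\<exists>d. \<forall>a\<in>A. (\<Sum>b | b \<in> A \<and> b \<le> a. d b) = v a"
  using assms
proof (induction A rule: finite_linorder_max_induct)
  case empty
  then show ?case by simp
next
  case (insert m A)
  then obtain d where d: "\<forall>a\<in>A. (\<Sum>b | b \<in> A \<and> b \<le> a. d b) = v a" by blast
  have m: "m \<notin> A" using insert by blast
  define d' where "d' = d(m := v m - sum d A)"
  have eq: "sum d' B = sum d B" if "B \<subseteq> A" for B
    using that m by (intro sum.cong) (auto simp: d'_def)
  have "(\<Sum>b | b \<in> insert m A \<and> b \<le> a. d' b) = v a" if "a \<in> insert m A" for a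
  proof (cases "a = m")
    case True
    then have "{b. b \<in> insert m A \<and> b \<le> a} = insert m A" using insert by auto
    then show ?thesis using True m \<open>finite A\<close> eq[of A] by (simp add: d'_def)
  next
    case False
    then have "a \<in> A" using that by simp
    then have "{b. b \<in> insert m A \<and> b \<le> a} = {b. b \<in> A \<and> b \<le> a}"
      using insert by auto
    then show ?thesis using d \<open>a \<in> A\<close> eq[of "{b. b \<in> A \<and> b \<le> a}"] by auto
  qed
  then show ?case by blast
qed

lemma lcro_interval_is_interval: "lcro_interval J \<Longrightarrow> is_interval J"
  unfolding lcro_interval_def
  by (auto simp: is_interval_ci is_interval_ic is_interval_io is_interval_co)

text \<open>As \<open>heaviside 0 = 0\<close>, a perceptron with nonzero weight fires exactly on an
  open half-line. The up-closure contains its left endpoint when it has one, so it is the complement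
  that is detected exactly.\<close>

lemma heaviside_complement_upclosure:
  assumes "lcro_interval J"
  shows "\<exists>w b. \<forall>x. heaviside (w * x + b) = (if \<exists>y\<in>J. y \<le> x then 0 else 1)"
proof -
  \<comment> \<open>A left endpoint, if finite, belongs to \<open>J\<close> and is its minimum;
    otherwise \<open>J\<close> is unbounded below.\<close>
  consider s where "s \<in> J" "\<forall>y\<in>J. s \<le> y" | "\<forall>x. \<exists>y\<in>J. y \<le> x"
    using assms unfolding lcro_interval_def
  proof (elim disjE exE conjE)
    fix t assume J: "J = {..<t}"
    have "\<exists>y\<in>J. y \<le> x" for x
      unfolding J by (rule bexI[of _ "min x (t - 1)"]) auto
    then show thesis using that by blast
  qed (force intro: that)+
  then show ?thesis
  proof cases
    case 1
    then have "(\<exists>y\<in>J. y \<le> x) \<longleftrightarrow> s \<le> x" for x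
      by (meson order_trans)
    then have "heaviside (- 1 * x + s) = (if \<exists>y\<in>J. y \<le> x then 0 else 1)" for x
      by (simp add: heaviside_def)
    then show ?thesis by blast
  next
    case 2
    then show ?thesis
      \<comment> \<open>Weight and bias are both 0, so the unit never fires.\<close>
      by (intro exI[of _ 0]) (auto simp: heaviside_def)
  qed
qed

text \<open>Of two disjoint intervals one lies entirely to the left of the other, so any choice of
  points from them compares the same way. Membership in an up-closure thus depends only on fixed
  representatives.\<close>

lemma upclosure_iff_representatives:
  fixes J K :: "real set"
  assumes "is_interval J" "is_interval K" "J \<inter> K = {} \<or> J = K"
    and "x \<in> J" "a \<in> J" "b \<in> K" "J = K \<Longrightarrow> a = b"
  shows "(\<exists>y\<in>K. y \<le> x) \<longleftrightarrow> b \<le> a"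
proof (cases "J = K")
  case True
  then show ?thesis using assms by auto
next
  case False
  then have disj: "z \<notin> K" if "z \<in> J" for z using assms(3) that by blast
  show ?thesis
  proof
    assume "\<exists>y\<in>K. y \<le> x"
    then obtain y where y: "y \<in> K" "y \<le> x" by blast
    \<comment> \<open>Otherwise \<open>a \<le> y \<le> x\<close> would put \<open>y\<close> into
      \<open>J\<close> by convexity.\<close>
    have "y < a"
      using mem_is_interval_1_I[OF assms(1) \<open>a \<in> J\<close> \<open>x \<in> J\<close>, of y] y disj by force
    \<comment> \<open>If \<open>a < b\<close>, then \<open>a\<close> would lie between
      \<open>y\<close> and \<open>b\<close>, hence in \<open>K\<close>.\<close>
    then show "b \<le> a"
      using mem_is_interval_1_I[OF assms(2) y(1) \<open>b \<in> K\<close>, of a] disj \<open>a \<in> J\<close> by force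
  next
    assume "b \<le> a"
    then have "b \<le> x"
      using mem_is_interval_1_I[OF assms(1) \<open>x \<in> J\<close> \<open>a \<in> J\<close>, of b] disj \<open>b \<in> K\<close> by force
    then show "\<exists>y\<in>K. y \<le> x" using \<open>b \<in> K\<close> by blast
  qed
qed

text \<open>Indices need not follow the order of the intervals on the line. One representative
  \<open>a k\<close> per interval supplies that order, and the sum over up-closures becomes a prefix
  sum over the representatives.\<close>

lemma step_function_as_upclosure_sum:
  fixes v :: "nat \<Rightarrow> 'b :: ab_group_add"
  assumes "context_partition c I"
  shows "\<exists>d. \<forall>j\<in>{1..c}. \<forall>x\<in>I j. (\<Sum>k = 1..c. if \<exists>y\<in>I k. y \<le> x then d k else 0) = v j"
proof -
  have part: "partition_on UNIV (I ` {1..c})" and inj: "inj_on I {1..c}"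
    and lcro: "\<And>j. j \<in> {1..c} \<Longrightarrow> lcro_interval (I j)"
    using assms by (auto simp: context_partition_def)
  have disj: "I j \<inter> I k = {} \<or> I j = I k" if "j \<in> {1..c}" "k \<in> {1..c}" for j k
    using part that unfolding partition_on_def disjoint_def by blast
  define a where "a j = (SOME x. x \<in> I j)" for j
  have a: "a j \<in> I j" if "j \<in> {1..c}" for j
  proof -
    have "I j \<noteq> {}" using part that unfolding partition_on_def by blast
    then show ?thesis unfolding a_def by (simp add: some_in_eq)
  qed
  have inj_a: "inj_on a {1..c}"
  proof (rule inj_onI)
    fix j k assume jk: "j \<in> {1..c}" "k \<in> {1..c}" "a j = a k"
    then have "I j = I k" using disj[OF jk(1,2)] a[OF jk(1)] a[OF jk(2)] by auto
    then show "j = k" using inj jk by (auto dest: inj_onD)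
  qed
  \<comment> \<open>\<open>the_inv_into\<close> carries the prescribed values from indices to
    representatives.\<close>
  obtain e where e: "\<forall>z\<in>a ` {1..c}.
      (\<Sum>b | b \<in> a ` {1..c} \<and> b \<le> z. e b) = v (the_inv_into {1..c} a z)"
    using exists_prefix_sum_inverse[of "a ` {1..c}" "\<lambda>z. v (the_inv_into {1..c} a z)"] by auto
  have "(\<Sum>k = 1..c. if \<exists>y\<in>I k. y \<le> x then e (a k) else 0) = v j"
    if j: "j \<in> {1..c}" and x: "x \<in> I j" for j x
  proof -
    have iff: "(\<exists>y\<in>I k. y \<le> x) \<longleftrightarrow> a k \<le> a j" if k: "k \<in> {1..c}" for k
      using inj j k
      by (intro upclosure_iff_representatives[OF _ _ disj[OF j k] x a[OF j] a[OF k]]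
          lcro_interval_is_interval lcro) (auto dest: inj_onD)
    have "(\<Sum>k = 1..c. if \<exists>y\<in>I k. y \<le> x then e (a k) else 0)
        = (\<Sum>k = 1..c. if a k \<le> a j then e (a k) else 0)"
      by (intro sum.cong) (simp_all add: iff)
    also have "\<dots> = (\<Sum>b\<in>a ` {1..c}. if b \<le> a j then e b else 0)"
      unfolding sum.reindex[OF inj_a] by simp
    also have "\<dots> = (\<Sum>b | b \<in> a ` {1..c} \<and> b \<le> a j. e b)"
      by (simp add: sum.inter_filter)
    also have "\<dots> = v j"
      using e the_inv_into_f_f[OF inj_a j] j by simp
    finally show ?thesis .
  qed
  then show ?thesis by (intro exI[of _ "\<lambda>k. e (a k)"]) blast
qed

lemma affine_bounded_on_compact:
  fixes S :: "'a :: real_inner set"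
  assumes "compact S"
  shows "\<exists>M. \<forall>x\<in>S. \<bar>d0 + d \<bullet> x\<bar> \<le> M"
proof -
  have "compact ((\<lambda>x. d0 + d \<bullet> x) ` S)"
    by (intro compact_continuous_image continuous_intros assms)
  then show ?thesis
    by (auto simp: bounded_iff dest!: compact_imp_bounded)
qed

text \<open>With the gate open, \<open>g + M\<close> and \<open>M\<close> are nonnegative and pass
  unchanged, leaving \<open>g\<close>; with it closed, the arguments \<open>g - M \<le> 0\<close>
  and 0 both give 0.\<close>

lemma relu_gate:
  assumes "\<bar>g\<bar> \<le> M"
  shows "relu (g + M - 2 * M * (if P then 0 else 1)) - relu (M - M * (if P then 0 else 1))
      = (if P then g else 0)"
  using assms by (auto simp: relu_def)

lemma sum_double_range:
  fixes u :: "nat \<Rightarrow> 'a :: comm_monoid_add"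
  shows "(\<Sum>k = 1..2 * c. u k) = (\<Sum>j = 1..c. u j + u (c + j))"
proof -
  have "(\<Sum>k = 1..2 * c. u k) = (\<Sum>k = 1..c. u k) + (\<Sum>k = c + 1..c + c. u k)"
    using sum.ub_add_nat[of 1 c u c] by (simp add: mult_2)
  also have "(\<Sum>k = c + 1..c + c. u k) = (\<Sum>k = 1..c. u (c + k))"
    using sum.shift_bounds_cl_nat_ivl[of u 1 c c] by (simp add: add.commute)
  finally show ?thesis by (simp add: sum.distrib)
qed

lemma sctxtnn_gated_sum:
  fixes S :: "(real ^ 'r::finite) set"
  assumes "compact S" and "\<And>j. j \<in> {1..c} \<Longrightarrow> lcro_interval (I j)"
  shows "\<exists>N :: 'r sctxtnn. \<forall>xh\<in>S. \<forall>xp. sctxtnn_output c N (xh, xp)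
      = (\<Sum>j = 1..c. if \<exists>y\<in>I j. y \<le> xp then d0 j + d j \<bullet> xh else 0)"
proof -
  have "\<forall>j. \<exists>M. \<forall>xh\<in>S. \<bar>d0 j + d j \<bullet> xh\<bar> \<le> M"
    by (intro allI affine_bounded_on_compact assms(1))
  from choice[OF this] obtain M
    where M: "\<And>j xh. xh \<in> S \<Longrightarrow> \<bar>d0 j + d j \<bullet> xh\<bar> \<le> M j"
    by blast
  obtain w b where wb: "\<And>j x. j \<in> {1..c} \<Longrightarrow>
      heaviside (w j * x + b j) = (if \<exists>y\<in>I j. y \<le> x then 0 else 1)"
    using heaviside_complement_upclosure[OF assms(2)] by metis
  (* Units j and c + j serve context j. *)
  define ctx where "ctx k = (if k \<le> c then k else k - c)" for k
  \<comment> \<open>The two halves of the hidden layer are the two terms of \<open>relu_gate\<close>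
    with \<open>g = d0 j + d j \<bullet> xh\<close>; the second half ignores the regressor features
    and is subtracted by the output weights.\<close>
  define N :: "'r sctxtnn" where "N = \<lparr>
      w_I = (\<lambda>k. w (ctx k)), b_I = (\<lambda>k. b (ctx k)),
      w_X = (\<lambda>k. if k \<le> c then - 2 * M k else - M (ctx k)),
      b_1 = (\<lambda>k. if k \<le> c then d0 k + M k else M (ctx k)),
      w_1 = (\<lambda>i k. if k \<le> c then d k $ i else 0),
      w_2 = (\<lambda>k. if k \<le> c then 1 else - 1), b_2 = 0\<rparr>"
  have "sctxtnn_output c N (xh, xp)
      = (\<Sum>j = 1..c. if \<exists>y\<in>I j. y \<le> xp then d0 j + d j \<bullet> xh else 0)"
    if xh: "xh \<in> S" for xh xp
  proof -
    have "w_2 N j * hidden_unit N (xh, xp) j + w_2 N (c + j) * hidden_unit N (xh, xp) (c + j)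
        = (if \<exists>y\<in>I j. y \<le> xp then d0 j + d j \<bullet> xh else 0)" if j: "j \<in> {1..c}" for j
    proof -
      let ?h = "if \<exists>y\<in>I j. y \<le> xp then 0 else 1 :: real"
      have h: "ctxt_unit N xp j = ?h" "ctxt_unit N xp (c + j) = ?h"
        using j wb[OF j, of xp] unfolding ctxt_unit_def by (simp_all add: N_def ctx_def)
      have "hidden_unit N (xh, xp) j = relu (d0 j + d j \<bullet> xh + M j - 2 * M j * ?h)"
        using j unfolding hidden_unit_def snd_conv h
        by (simp add: N_def inner_vec_def ac_simps)
      moreover have "hidden_unit N (xh, xp) (c + j) = relu (M j - M j * ?h)"
        using j unfolding hidden_unit_def snd_conv h by (simp add: N_def ctx_def)
      moreover have "w_2 N j = 1" "w_2 N (c + j) = - 1"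
        using j by (simp_all add: N_def)
      ultimately show ?thesis
        using relu_gate[OF M[OF xh, of j], where P = "\<exists>y\<in>I j. y \<le> xp"] by simp
    qed
    moreover have "b_2 N = 0" by (simp add: N_def)
    ultimately show ?thesis
      unfolding sctxtnn_output_def sum_double_range by simp
  qed
  then show ?thesis by blast
qed

theorem proposition1:
  fixes c :: nat
    and I :: "nat \<Rightarrow> real set"
    and \<beta>0 :: "nat \<Rightarrow> real"
    and \<beta> :: "nat \<Rightarrow> real ^ 'r::finite"
    and f :: "(real ^ 'r) \<times> real \<Rightarrow> real"
    and S :: "(real ^ 'r) set"
    and T :: "real set"
  assumes "c \<ge> 1"
    and "context_partition c I"
    and "ctxt_linear_regression c I \<beta>0 \<beta> f"
    and "compact S"
    and "is_interval T" and "bounded T"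
    and "\<And>j. j \<in> {1..c} \<Longrightarrow> T \<inter> I j \<noteq> {}"
  shows "\<exists>N :: 'r sctxtnn. \<forall>x \<in> S \<times> T. sctxtnn_output c N x = f x"
proof -
  \<comment> \<open>Intercept and slope are decomposed together, as one value in the product
    space.\<close>
  obtain d where d: "\<forall>j\<in>{1..c}. \<forall>x\<in>I j.
      (\<Sum>k = 1..c. if \<exists>y\<in>I k. y \<le> x then d k else 0) = (\<beta>0 j, \<beta> j)"
    using step_function_as_upclosure_sum[OF assms(2), of "\<lambda>j. (\<beta>0 j, \<beta> j)"] by blast
  obtain N :: "'r sctxtnn" where N: "\<forall>xh\<in>S. \<forall>xp. sctxtnn_output c N (xh, xp)
      = (\<Sum>j = 1..c. if \<exists>y\<in>I j. y \<le> xp then fst (d j) + snd (d j) \<bullet> xh else 0)"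
    using sctxtnn_gated_sum[OF assms(4), of c I "\<lambda>j. fst (d j)" "\<lambda>j. snd (d j)"] assms(2)
    by (auto simp: context_partition_def)
  have "sctxtnn_output c N (xh, xp) = f (xh, xp)" if xh: "xh \<in> S" for xh xp
  proof -
    obtain j where j: "j \<in> {1..c}" "xp \<in> I j"
      using assms(2) unfolding context_partition_def partition_on_def by blast
    \<comment> \<open>An affine map at \<open>xh\<close> is the inner product of its coefficient
      pair with \<open>(1, xh)\<close>, so linearity moves the sum onto the coefficients.\<close>
    have "sctxtnn_output c N (xh, xp)
        = (\<Sum>k = 1..c. (1, xh) \<bullet> (if \<exists>y\<in>I k. y \<le> xp then d k else 0))"
      unfolding N[rule_format, OF xh]
      by (intro sum.cong) (auto simp: inner_prod_def inner_commute)
    also have "\<dots> = (1, xh) \<bullet> (\<beta>0 j, \<beta> j)"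
      using d j by (simp flip: inner_sum_right)
    also have "\<dots> = f (xh, xp)"
      using assms(3) j by (simp add: ctxt_linear_regression_def inner_commute)
    finally show ?thesis .
  qed
  then show ?thesis by auto
qed

end
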